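(* Fix a node $i$, a slot $t$, $V>0$, a queue state $(Q_\tau(t),Q_c(t),Q_\rho(t))\in[0,\infty)^3$ and a cloud-load estimate $\rho\in[0,1]$. Assume the gain functions $G_{1,i},G_{2,i}:[0,1]\to\mathbb{R}$ are continuous and nondecreasing. Then: (1) For every routing score $r\in[0,1]$, an action $a\in\{0,1,2\}$ minimizes the conditional surrogate routing objective $\bar\Psi_{i,t}(a;r,\rho)$ over $\{0,1,2\}$ if and only if it minimizes the routing indices, i.e. $a\in\arg\min_{a'\in\{0,1,2\}}J^{(a')}_{i,t}$, where $J^{(0)}_{i,t}=0$, $J^{(1)}_{i,t}=J^{(1)}_{i,t}(r)$, $J^{(2)}_{i,t}=J^{(2)}_{i,t}(r,\rho)$. (2) Each of the three pairwise comparisons $$J_{i,t}^{(1)}(r)\le J_{i,t}^{(0)},\qquad J_{i,t}^{(2)}(r,\rho)\le J_{i,t}^{(0)},\qquad J_{i,t}^{(2)}(r,\rho)\le J_{i,t}^{(1)}(r)$$ is triggered by a scalar threshold in $r$: there are $\theta_{01},\theta_{02},\theta_{12}\in[0,1]\cup\{+\infty\}$ (depending on $i,t$ and, for the last two, on $\rho$) such that, for all $r\in[0,1]$, the first, second and third comparison holds if and only if $r\ge\theta_{01}$, $r\ge\theta_{02}$, $r\ge\theta_{12}$, respectively. (3) Hence the optimal action is determined by a threshold-type partition of $[0,1]$: there are pairwise disjoint, possibly empty intervals $I_0,I_1,I_2$ with union $[0,1]$, whose endpoints belong to $\{0,1,\theta_{01},\theta_{02},\theta_{12}\}$, such that for every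 $a\in\{0,1,2\}$ and every $r\in I_a$ the action $a$ minimizes $\bar\Psi_{i,t}(\cdot\,;r,\rho)$.
   Context: A node $i$ chooses at slot $t$ an inference mode $a\in\{0,1,2\}$. Mode latencies: $\tau_i^{(0)}$, $\tau_i^{(1)}$ are nonnegative constants and $\tau_i^{(2)}(\rho)\ge 0$ is a function of the cloud-load estimate $\rho\in[0,1]$; write $\tau_i^{(0)}(\rho)=\tau_i^{(0)}$ and $\tau_i^{(1)}(\rho)=\tau_i^{(1)}$. (In the system model, $\tau_i^{(0)}=\tau_i^e$, $\tau_i^{(1)}=\tau_i^e+\tau_i^s+\tau_i^f$, $\tau_i^{(2)}(\rho)=\tau_i^e+\tau_i^f+\max\{\tau_i^s,\tau_i^{\mathrm{up}}+\phi(\rho)+\tau^{\mathrm{cld}}+\tau_i^{\mathrm{down}}\}$ with nonnegative constants and $\phi:[0,1]\to[0,\infty)$ continuous nondecreasing.) Communication costs: $c_i^{(0)}=c_i^{(1)}=0$, $c_i^{(2)}=\kappa_i\ge 0$. $Q_\tau(t),Q_c(t),Q_\rho(t)\ge 0$ are virtual queue values and $V>0$ is a trade-off parameter. $r_{i,t}\in[0,1]$ is the (random) routing score of node $i$, and for each $a$, $\widehat{\ell}^{(a)}_{i,t}$ is a bounded random surrogate loss of mode $a$. The gain functions are $$G_{1,i}(r)=\mathbb{E}\big[\widehat{\ell}^{(0)}_{i,t}-\widehat{\ell}^{(1)}_{i,t}\mid r_{i,t}=r\big],\qquad G_{2,i}(r)=\mathbb{E}\big[\widehat{\ell}^{(1)}_{i,t}-\widehat{\ell}^{(2)}_{i,t}\mid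 r_{i,t}=r\big],$$ where for each $a$ a fixed version of $r\mapsto\mathbb{E}[\widehat{\ell}^{(a)}_{i,t}\mid r_{i,t}=r]$, $r\in[0,1]$, is used throughout. The conditional surrogate routing objective is $$\bar\Psi_{i,t}(a;r,\rho)=V\,\mathbb{E}\big[\widehat{\ell}^{(a)}_{i,t}\mid r_{i,t}=r\big]+Q_\tau(t)\tau_i^{(a)}(\rho)+Q_c(t)c_i^{(a)}+Q_\rho(t)\mathbb{I}\{a=2\}.$$ Define $$\kappa^{(1)}_{i,t}=Q_\tau(t)\big(\tau_i^{(1)}-\tau_i^{(0)}\big),\qquad \kappa^{(2)}_{i,t}(\rho)=Q_\tau(t)\big(\tau_i^{(2)}(\rho)-\tau_i^{(1)}\big)+Q_c(t)\kappa_i+Q_\rho(t),$$ and the routing indices $$J^{(0)}_{i,t}=0,\qquad J^{(1)}_{i,t}(r)=\frac{\kappa^{(1)}_{i,t}}{V}-G_{1,i}(r),\qquad J^{(2)}_{i,t}(r,\rho)=\frac{\kappa^{(1)}_{i,t}+\kappa^{(2)}_{i,t}(\rho)}{V}-G_{1,i}(r)-G_{2,i}(r).$$ *)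

theory Defs
  imports "HOL-Probability.Probability"
begin

text \<open>
  All data refer to one arbitrary node \<open>i\<close> and one arbitrary slot \<open>t\<close>; the indices are suppressed.
  Inference modes are the naturals \<open>0, 1, 2\<close>.
\<close>

abbreviation modes :: "nat set" where
  "modes \<equiv> {0, 1, 2}"

record node_params =
  tau0 :: real
  tau1 :: real
  tau2 :: "real \<Rightarrow> real"
  comm :: real

definition valid_node :: "node_params \<Rightarrow> bool" where
  "valid_node nd \<longleftrightarrow> 0 \<le> tau0 nd \<and> 0 \<le> tau1 nd \<and> (\<forall>\<rho>\<in>{0..1}. 0 \<le> tau2 nd \<rho>) \<and> 0 \<le> comm nd"

definition latency :: "node_params \<Rightarrow> nat \<Rightarrow> real \<Rightarrow> real" where
  "latency nd a \<rho> = (if a = 0 then tau0 nd else if a = 1 then tau1 nd else tau2 nd \<rho>)"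

definition comm_cost :: "node_params \<Rightarrow> nat \<Rightarrow> real" where
  "comm_cost nd a = (if a = 2 then comm nd else 0)"

record queue_state =
  Q_tau :: real
  Q_c :: real
  Q_rho :: real

definition valid_queues :: "queue_state \<Rightarrow> bool" where
  "valid_queues q \<longleftrightarrow> 0 \<le> Q_tau q \<and> 0 \<le> Q_c q \<and> 0 \<le> Q_rho q"

text \<open>
  \<open>cond_exp_version M R X g\<close>: the function \<open>g\<close> on \<open>[0,1]\<close> is a version of
  \<open>r \<mapsto> E[X | R = r]\<close>, i.e. \<open>g\<close> is Borel and \<open>g \<circ> R\<close> is a version of \<open>E[X | \<sigma>(R)]\<close>.
\<close>

definition cond_exp_version ::
    "'w measure \<Rightarrow> ('w \<Rightarrow> real) \<Rightarrow> ('w \<Rightarrow> real) \<Rightarrow> (real \<Rightarrow> real) \<Rightarrow> bool" where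
  "cond_exp_version M R X g \<longleftrightarrow>
     g \<in> borel_measurable (restrict_space borel {0..1}) \<and>
     (AE w in M. g (R w) = real_cond_exp M (vimage_algebra (space M) R borel) X w)"

text \<open>
  In what follows \<open>m a\<close> is the fixed version of \<open>r \<mapsto> E[loss a | R = r]\<close>. The gains are formed
  from these versions; lemma \<open>cond_exp_version_diff\<close> shows that they are versions of the
  conditional expectations of the loss differences.
\<close>

definition gain1 :: "(nat \<Rightarrow> real \<Rightarrow> real) \<Rightarrow> real \<Rightarrow> real" where
  "gain1 m r = m 0 r - m 1 r"

definition gain2 :: "(nat \<Rightarrow> real \<Rightarrow> real) \<Rightarrow> real \<Rightarrow> real" where
  "gain2 m r = m 1 r - m 2 r"

lemma (in prob_space) cond_exp_version_diff:
  assumes R: "R \<in> borel_measurable M"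
    and X: "integrable M X" and Y: "integrable M Y"
    and g: "cond_exp_version M R X g" and h: "cond_exp_version M R Y h"
  shows "cond_exp_version M R (\<lambda>w. X w - Y w) (\<lambda>r. g r - h r)"
proof -
  let ?F = "vimage_algebra (space M) R borel"
  have sub: "subalgebra M ?F"
    using R by (auto simp: subalgebra_def sets_vimage_algebra2 intro: measurable_sets)
  then interpret finite_measure_subalgebra M ?F
    by unfold_locales
  have "AE w in M. real_cond_exp M ?F (\<lambda>w. X w - Y w) w
          = real_cond_exp M ?F X w - real_cond_exp M ?F Y w"
    using X Y by (rule real_cond_exp_diff)
  then show ?thesis
    using g h by (auto simp: cond_exp_version_def)
qed

definition Psi_bar ::
    "real \<Rightarrow> queue_state \<Rightarrow> node_params \<Rightarrow> (nat \<Rightarrow> real \<Rightarrow> real) \<Rightarrow> nat \<Rightarrow> real \<Rightarrow> real \<Rightarrow> real" where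
  "Psi_bar V q nd m a r \<rho> =
     V * m a r + Q_tau q * latency nd a \<rho> + Q_c q * comm_cost nd a + Q_rho q * indicator {2} a"

definition kappa1 :: "queue_state \<Rightarrow> node_params \<Rightarrow> real" where
  "kappa1 q nd = Q_tau q * (tau1 nd - tau0 nd)"

definition kappa2 :: "queue_state \<Rightarrow> node_params \<Rightarrow> real \<Rightarrow> real" where
  "kappa2 q nd \<rho> = Q_tau q * (tau2 nd \<rho> - tau1 nd) + Q_c q * comm nd + Q_rho q"

definition J0 :: real where
  "J0 = 0"

definition J1 ::
    "real \<Rightarrow> queue_state \<Rightarrow> node_params \<Rightarrow> (nat \<Rightarrow> real \<Rightarrow> real) \<Rightarrow> real \<Rightarrow> real" where
  "J1 V q nd m r = kappa1 q nd / V - gain1 m r"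

definition J2 ::
    "real \<Rightarrow> queue_state \<Rightarrow> node_params \<Rightarrow> (nat \<Rightarrow> real \<Rightarrow> real) \<Rightarrow> real \<Rightarrow> real \<Rightarrow> real" where
  "J2 V q nd m r \<rho> = (kappa1 q nd + kappa2 q nd \<rho>) / V - gain1 m r - gain2 m r"

definition routing_index ::
    "real \<Rightarrow> queue_state \<Rightarrow> node_params \<Rightarrow> (nat \<Rightarrow> real \<Rightarrow> real) \<Rightarrow> nat \<Rightarrow> real \<Rightarrow> real \<Rightarrow> real" where
  "routing_index V q nd m a r \<rho> =
     (if a = 0 then J0 else if a = 1 then J1 V q nd m r else J2 V q nd m r \<rho>)"

definition thresholds :: "ereal set" where
  "thresholds = ereal ` {0..1} \<union> {\<infinity>}"

text \<open>The empty interval satisfies this for every \<open>E\<close>; it is applied to bounded \<open>I\<close> only.\<close>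

definition interval_with_endpoints_in :: "real set \<Rightarrow> ereal set \<Rightarrow> bool" where
  "interval_with_endpoints_in I E \<longleftrightarrow>
     is_interval I \<and> (I \<noteq> {} \<longrightarrow> ereal (Inf I) \<in> E \<and> ereal (Sup I) \<in> E)"

end

theory Submission
  imports Defs
begin

text \<open>
  Dividing by \<open>V\<close> and subtracting the value at \<open>a = 0\<close>, which does not depend on \<open>a\<close>, turns the
  objective into the routing index. Each pairwise comparison says that a continuous nondecreasing
  function of \<open>r\<close> is at least a constant, so its solution set in \<open>[0,1]\<close> is closed and upward
  closed. Mode 2 is assigned to \<open>r \<ge> max \<theta>02 \<theta>12\<close>, mode 1 to the remaining \<open>r \<ge> \<theta>01\<close>, and
  mode 0 to the rest.
\<close>

text \<open>The threshold is the infimum of the superlevel set. Continuity makes it attained, hence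
  the non-strict comparison with \<open>\<theta>\<close>, and monotonicity puts every larger score
  into the set. If the set is empty, the value \<open>\<infinity>\<close> encodes a comparison that
  never holds.\<close>

lemma ex_superlevel_threshold:
  fixes g :: "real \<Rightarrow> real"
  assumes cont: "continuous_on {0..1} g" and mono: "mono_on {0..1} g"
  obtains \<theta> where "\<theta> \<in> thresholds" and "\<And>r. r \<in> {0..1} \<Longrightarrow> c \<le> g r \<longleftrightarrow> \<theta> \<le> ereal r"
proof (cases "\<exists>r\<in>{0..1}. c \<le> g r")
  case False
  then show ?thesis
    by (intro that[of "\<infinity>"]) (auto simp: thresholds_def)
next
  case True
  define S where "S = {r \<in> {0..1}. c \<le> g r}"
  have "closed S"
    using continuous_closed_preimage[OF cont closed_atLeastAtMost closed_atLeast, of c]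
    by (simp add: S_def vimage_def Int_def)
  moreover have "S \<noteq> {}" "bdd_below S"
    using True by (auto simp: S_def)
  ultimately have S: "Inf S \<in> S"
    using closed_contains_Inf by blast
  show ?thesis
  proof (rule that[of "ereal (Inf S)"])
    show "ereal (Inf S) \<in> thresholds"
      using S by (auto simp: thresholds_def S_def)
    fix r :: real assume r: "r \<in> {0..1}"
    show "c \<le> g r \<longleftrightarrow> ereal (Inf S) \<le> ereal r"
    proof
      assume "c \<le> g r"
      then show "ereal (Inf S) \<le> ereal r"
        using r \<open>bdd_below S\<close> by (auto simp: S_def intro: cInf_lower)
    next
      assume "ereal (Inf S) \<le> ereal r"
      then have "g (Inf S) \<le> g r"
        using S r mono by (auto simp: S_def mono_on_def)
      then show "c \<le> g r"
        using S by (auto simp: S_def)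
    qed
  qed
qed

text \<open>A nonempty set forces \<open>a\<close> to be real. For real \<open>b\<close> the set is
  half-open with supremum \<open>b\<close>; for \<open>b = \<infinity>\<close> it is closed and
  stops at 1, which is why the upper endpoint is capped as \<open>min b 1\<close>.\<close>

lemma interval_with_endpoints_in_thresholds:
  assumes "a \<in> thresholds" "b \<in> thresholds"
  shows "interval_with_endpoints_in {r \<in> {0..1}. a \<le> ereal r \<and> ereal r < b} {a, min b 1}"
    (is "interval_with_endpoints_in ?I _")
proof -
  have "is_interval ?I"
    unfolding is_interval_1
    by (auto intro: order_trans[of a] order.strict_trans1[where b = "ereal _" and c = b])
  moreover have "ereal (Inf ?I) = a \<and> ereal (Sup ?I) = min b 1" if "?I \<noteq> {}"
  proof -
    have "a \<noteq> \<infinity>"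
      using that by auto
    then obtain x where x: "a = ereal x" "x \<in> {0..1}"
      using assms(1) by (auto simp: thresholds_def)
    show ?thesis
    proof (cases b)
      case PInf
      then have "?I = {x..1}"
        using x by auto
      then show ?thesis
        using x PInf by (simp add: one_ereal_def)
    next
      case (real y)
      then have "y \<le> 1"
        using assms(2) by (auto simp: thresholds_def)
      then have I: "?I = {x..<y}"
        using x real by auto
      \<comment> \<open>Strictness matters: only a nonempty half-open interval has its bounds as
        infimum and supremum.\<close>
      then have "x < y"
        using that by auto
      then show ?thesis
        unfolding I using x real \<open>y \<le> 1\<close> by (simp add: one_ereal_def)
    next
      case MInf
      then show ?thesis
        using that by auto
    qed
  qed
  ultimately show ?thesis
    by (simp add: interval_with_endpoints_in_def)
qed

lemma interval_with_endpoints_in_mono: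
  "interval_with_endpoints_in I E \<Longrightarrow> E \<subseteq> F \<Longrightarrow> interval_with_endpoints_in I F"
  by (auto simp: interval_with_endpoints_in_def)

lemma is_arg_min_affine_iff:
  fixes f :: "'a \<Rightarrow> real"
  assumes "0 < V" and "\<And>a. P a \<Longrightarrow> g a = V * f a + c"
  shows "is_arg_min g P a \<longleftrightarrow> is_arg_min f P a"
  using assms by (auto simp: is_arg_min_def)

text \<open>For mode 2 both sums telescope: the two gains add up to \<open>m 0 r - m 2 r\<close>,
  and \<open>kappa1\<close> plus \<open>kappa2\<close> leaves the latency difference between modes 2
  and 0 together with the communication and load terms.\<close>

lemma Psi_bar_eq_routing_index:
  assumes "V \<noteq> 0" "a \<in> modes"
  shows "Psi_bar V q nd m a r \<rho> = V * routing_index V q nd m a r \<rho> + Psi_bar V q nd m 0 r \<rho>"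
  using assms
  by (auto simp: Psi_bar_def routing_index_def J0_def J1_def J2_def gain1_def gain2_def
      kappa1_def kappa2_def latency_def comm_cost_def field_simps)

lemma is_arg_min_Psi_bar_iff:
  assumes "0 < V"
  shows "is_arg_min (\<lambda>a'. Psi_bar V q nd m a' r \<rho>) (\<lambda>a'. a' \<in> modes) a \<longleftrightarrow>
    is_arg_min (\<lambda>a'. routing_index V q nd m a' r \<rho>) (\<lambda>a'. a' \<in> modes) a"
  by (rule is_arg_min_affine_iff[OF assms Psi_bar_eq_routing_index]) (use assms in auto)

text \<open>The pairwise comparisons alone decide which mode is minimal, so three abstract functions
  suffice. The construction works for every order of the thresholds.\<close>

lemma ex_threshold_partition:
  fixes j0 j1 j2 :: "real \<Rightarrow> real"
  assumes \<theta>: "\<theta>01 \<in> thresholds" "\<theta>02 \<in> thresholds" "\<theta>12 \<in> thresholds"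
    and 01: "\<And>r. r \<in> {0..1} \<Longrightarrow> j1 r \<le> j0 r \<longleftrightarrow> \<theta>01 \<le> ereal r"
    and 02: "\<And>r. r \<in> {0..1} \<Longrightarrow> j2 r \<le> j0 r \<longleftrightarrow> \<theta>02 \<le> ereal r"
    and 12: "\<And>r. r \<in> {0..1} \<Longrightarrow> j2 r \<le> j1 r \<longleftrightarrow> \<theta>12 \<le> ereal r"
  obtains I :: "nat \<Rightarrow> real set" where
    "disjoint_family_on I modes" "(\<Union>a\<in>modes. I a) = {0..1}"
    "\<And>a. a \<in> modes \<Longrightarrow> interval_with_endpoints_in (I a) {0, 1, \<theta>01, \<theta>02, \<theta>12}"
    "\<And>a r. a \<in> modes \<Longrightarrow> r \<in> I a \<Longrightarrow>
       is_arg_min (\<lambda>a'. if a' = 0 then j0 r else if a' = 1 then j1 r else j2 r)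
         (\<lambda>a'. a' \<in> modes) a"
proof -
  \<comment> \<open>Mode 2 is minimal exactly when it beats both other modes, that is, from the
    larger of its two thresholds on.\<close>
  define \<theta>2 where "\<theta>2 = max \<theta>02 \<theta>12"
  \<comment> \<open>Intervals are closed below and open above, so ties at a threshold go to the
    higher mode. The bound \<open>\<infinity>\<close> for mode 2 keeps the score 1 available. If
    \<open>\<theta>2 \<le> \<theta>01\<close>, mode 1 gets the empty set and mode 0 ends at
    \<open>\<theta>2\<close>, hence the minimum in \<open>hi\<close>.\<close>
  define lo hi where
    "lo = (\<lambda>a::nat. if a = 0 then 0 else if a = 1 then \<theta>01 else \<theta>2)" and
    "hi = (\<lambda>a::nat. if a = 0 then min \<theta>01 \<theta>2 else if a = 1 then \<theta>2 else \<infinity>)"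
  define I where "I = (\<lambda>a. {r \<in> {0..1}. lo a \<le> ereal r \<and> ereal r < hi a})"
  have "\<theta>2 \<in> thresholds" "0 \<in> thresholds" "\<infinity> \<in> thresholds"
    using \<theta> by (auto simp: \<theta>2_def max_def thresholds_def zero_ereal_def)
  then have lo_hi: "lo a \<in> thresholds" "hi a \<in> thresholds" for a
    using \<theta> by (auto simp: lo_def hi_def min_def)
  show ?thesis
  proof (rule that[of I])
    show "disjoint_family_on I modes"
      by (auto simp: disjoint_family_on_def I_def lo_def hi_def)
    show "(\<Union>a\<in>modes. I a) = {0..1}"
      by (auto simp: I_def lo_def hi_def not_le)
  next
    fix a assume "a \<in> modes"
    have "{lo a, min (hi a) 1} \<subseteq> {0, 1, \<theta>01, \<theta>02, \<theta>12}"
      by (auto simp: lo_def hi_def \<theta>2_def min_def max_def)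
    with interval_with_endpoints_in_thresholds[OF lo_hi]
    show "interval_with_endpoints_in (I a) {0, 1, \<theta>01, \<theta>02, \<theta>12}"
      unfolding I_def by (rule interval_with_endpoints_in_mono)
  next
    fix a r assume a: "a \<in> modes" and r: "r \<in> I a"
    then have "r \<in> {0..1}"
      by (simp add: I_def)
    note cmp = 01[OF this] 02[OF this] 12[OF this]
    from a consider "a = 0" | "a = 1" | "a = 2"
      by blast
    then show "is_arg_min (\<lambda>a'. if a' = 0 then j0 r else if a' = 1 then j1 r else j2 r)
        (\<lambda>a'. a' \<in> modes) a"
    proof cases
      case 1
      \<comment> \<open>Below \<open>\<theta>2\<close>, mode 2 loses strictly to mode 0 or to mode
        1. In the latter case \<open>j0 r < j1 r < j2 r\<close>, so mode 0 is still minimal.\<close>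
      then have "\<not> j1 r \<le> j0 r" "\<not> (j2 r \<le> j0 r \<and> j2 r \<le> j1 r)"
        using r unfolding cmp by (auto simp: I_def lo_def hi_def \<theta>2_def not_le less_max_iff_disj)
      with 1 show ?thesis
        by (auto simp: is_arg_min_linorder)
    next
      case 2
      \<comment> \<open>If mode 2 loses to mode 0 rather than directly to mode 1, then
        \<open>j1 r \<le> j0 r < j2 r\<close> gives the missing comparison.\<close>
      then have "j1 r \<le> j0 r" "\<not> (j2 r \<le> j0 r \<and> j2 r \<le> j1 r)"
        using r unfolding cmp by (auto simp: I_def lo_def hi_def \<theta>2_def not_le less_max_iff_disj)
      with 2 show ?thesis
        by (auto simp: is_arg_min_linorder)
    next
      case 3
      then have "j2 r \<le> j0 r" "j2 r \<le> j1 r"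
        using r unfolding cmp by (auto simp: I_def lo_def hi_def \<theta>2_def)
      with 3 show ?thesis
        by (auto simp: is_arg_min_linorder)
    qed
  qed
qed

theorem mainTheorem1:
  fixes M :: "'w measure"
    and R :: "'w \<Rightarrow> real"
    and loss :: "nat \<Rightarrow> 'w \<Rightarrow> real"
    and m :: "nat \<Rightarrow> real \<Rightarrow> real"
    and nd :: node_params
    and q :: queue_state
    and V :: real
  assumes "prob_space M"
    and "R \<in> borel_measurable M"
    and "\<And>w. w \<in> space M \<Longrightarrow> R w \<in> {0..1}"
    and "\<And>a. a \<in> modes \<Longrightarrow> loss a \<in> borel_measurable M"
    and "\<And>a. a \<in> modes \<Longrightarrow> \<exists>B. \<forall>w\<in>space M. \<bar>loss a w\<bar> \<le> B"
    and "\<And>a. a \<in> modes \<Longrightarrow> cond_exp_version M R (loss a) (m a)"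
    and "valid_node nd"
    and "valid_queues q"
    and "V > 0"
    and "continuous_on {0..1} (gain1 m)" and "mono_on {0..1} (gain1 m)"
    and "continuous_on {0..1} (gain2 m)" and "mono_on {0..1} (gain2 m)"
  shows
    "(\<forall>\<rho>\<in>{0..1}. \<forall>r\<in>{0..1}. \<forall>a\<in>modes.
        is_arg_min (\<lambda>a'. Psi_bar V q nd m a' r \<rho>) (\<lambda>a'. a' \<in> modes) a \<longleftrightarrow>
        is_arg_min (\<lambda>a'. routing_index V q nd m a' r \<rho>) (\<lambda>a'. a' \<in> modes) a)
     \<and>
     (\<exists>\<theta>01\<in>thresholds.
        (\<forall>r\<in>{0..1}. J1 V q nd m r \<le> J0 \<longleftrightarrow> ereal r \<ge> \<theta>01) \<and>
        (\<forall>\<rho>\<in>{0..1}. \<exists>\<theta>02\<in>thresholds. \<exists>\<theta>12\<in>thresholds.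
           (\<forall>r\<in>{0..1}. J2 V q nd m r \<rho> \<le> J0 \<longleftrightarrow> ereal r \<ge> \<theta>02) \<and>
           (\<forall>r\<in>{0..1}. J2 V q nd m r \<rho> \<le> J1 V q nd m r \<longleftrightarrow> ereal r \<ge> \<theta>12) \<and>
           (\<exists>I :: nat \<Rightarrow> real set.
              disjoint_family_on I modes \<and>
              (\<Union>a\<in>modes. I a) = {0..1} \<and>
              (\<forall>a\<in>modes. interval_with_endpoints_in (I a) {0, 1, \<theta>01, \<theta>02, \<theta>12}) \<and>
              (\<forall>a\<in>modes. \<forall>r\<in>I a.
                 is_arg_min (\<lambda>a'. Psi_bar V q nd m a' r \<rho>) (\<lambda>a'. a' \<in> modes) a))))"
proof (intro conjI ballI)
  fix \<rho> r :: real and a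
  show "is_arg_min (\<lambda>a'. Psi_bar V q nd m a' r \<rho>) (\<lambda>a'. a' \<in> modes) a \<longleftrightarrow>
    is_arg_min (\<lambda>a'. routing_index V q nd m a' r \<rho>) (\<lambda>a'. a' \<in> modes) a"
    using \<open>V > 0\<close> by (rule is_arg_min_Psi_bar_iff)
next
  let ?G = "\<lambda>r. gain1 m r + gain2 m r"
  note gains = assms(10-13)
  \<comment> \<open>Comparing modes 2 and 0 involves the total gain, which inherits continuity and
    monotonicity from its summands.\<close>
  have G: "continuous_on {0..1} ?G" "mono_on {0..1} ?G"
    using gains by (auto intro: continuous_on_add simp: mono_on_def add_mono)
  \<comment> \<open>This threshold is chosen before \<open>\<rho>\<close> is fixed, so it is the
    same for all cloud loads.\<close>
  obtain \<theta>01 where \<theta>01: "\<theta>01 \<in> thresholds"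
    and "\<And>r. r \<in> {0..1} \<Longrightarrow> kappa1 q nd / V \<le> gain1 m r \<longleftrightarrow> \<theta>01 \<le> ereal r"
    using ex_superlevel_threshold[OF gains(1,2)] by blast
  then have 01: "J1 V q nd m r \<le> J0 \<longleftrightarrow> \<theta>01 \<le> ereal r" if "r \<in> {0..1}" for r
    using that by (simp add: J0_def J1_def)
  show "\<exists>\<theta>01\<in>thresholds.
        (\<forall>r\<in>{0..1}. J1 V q nd m r \<le> J0 \<longleftrightarrow> ereal r \<ge> \<theta>01) \<and>
        (\<forall>\<rho>\<in>{0..1}. \<exists>\<theta>02\<in>thresholds. \<exists>\<theta>12\<in>thresholds.
           (\<forall>r\<in>{0..1}. J2 V q nd m r \<rho> \<le> J0 \<longleftrightarrow> ereal r \<ge> \<theta>02) \<and>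
           (\<forall>r\<in>{0..1}. J2 V q nd m r \<rho> \<le> J1 V q nd m r \<longleftrightarrow> ereal r \<ge> \<theta>12) \<and>
           (\<exists>I :: nat \<Rightarrow> real set.
              disjoint_family_on I modes \<and>
              (\<Union>a\<in>modes. I a) = {0..1} \<and>
              (\<forall>a\<in>modes. interval_with_endpoints_in (I a) {0, 1, \<theta>01, \<theta>02, \<theta>12}) \<and>
              (\<forall>a\<in>modes. \<forall>r\<in>I a.
                 is_arg_min (\<lambda>a'. Psi_bar V q nd m a' r \<rho>) (\<lambda>a'. a' \<in> modes) a)))"
    (is "\<exists>\<theta>01\<in>_. ?P01 \<theta>01 \<and> (\<forall>\<rho>\<in>_. ?Q \<theta>01 \<rho>)")
  proof (rule bexI[OF _ \<theta>01], rule conjI; rule ballI)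
    show "J1 V q nd m r \<le> J0 \<longleftrightarrow> \<theta>01 \<le> ereal r" if "r \<in> {0..1}" for r
      using that by (rule 01)
    fix \<rho> :: real
    obtain \<theta>02 where \<theta>02: "\<theta>02 \<in> thresholds"
      and "\<And>r. r \<in> {0..1} \<Longrightarrow> (kappa1 q nd + kappa2 q nd \<rho>) / V \<le> ?G r \<longleftrightarrow> \<theta>02 \<le> ereal r"
      using ex_superlevel_threshold[OF G] by blast
    then have 02: "J2 V q nd m r \<rho> \<le> J0 \<longleftrightarrow> \<theta>02 \<le> ereal r" if "r \<in> {0..1}" for r
      using that by (simp add: J0_def J2_def algebra_simps)
    \<comment> \<open>Between modes 2 and 1 the terms \<open>kappa1 q nd / V\<close> and
      \<open>gain1 m r\<close> cancel, leaving a condition on \<open>gain2\<close> alone.\<close>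
    obtain \<theta>12 where \<theta>12: "\<theta>12 \<in> thresholds"
      and "\<And>r. r \<in> {0..1} \<Longrightarrow> kappa2 q nd \<rho> / V \<le> gain2 m r \<longleftrightarrow> \<theta>12 \<le> ereal r"
      using ex_superlevel_threshold[OF gains(3,4)] by blast
    then have 12: "J2 V q nd m r \<rho> \<le> J1 V q nd m r \<longleftrightarrow> \<theta>12 \<le> ereal r" if "r \<in> {0..1}" for r
      using that by (simp add: J1_def J2_def add_divide_distrib)
    obtain I :: "nat \<Rightarrow> real set" where
      "disjoint_family_on I modes" "(\<Union>a\<in>modes. I a) = {0..1}"
      "\<And>a. a \<in> modes \<Longrightarrow> interval_with_endpoints_in (I a) {0, 1, \<theta>01, \<theta>02, \<theta>12}"
      "\<And>a r. a \<in> modes \<Longrightarrow> r \<in> I a \<Longrightarrow>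
         is_arg_min (\<lambda>a'. routing_index V q nd m a' r \<rho>) (\<lambda>a'. a' \<in> modes) a"
      \<comment> \<open>The unfolded index is the conditional expression of the partition lemma,
        with \<open>J0\<close> read as a constant function of the score.\<close>
      unfolding routing_index_def
      using ex_threshold_partition[of \<theta>01 \<theta>02 \<theta>12 "J1 V q nd m" "\<lambda>_. J0"
          "\<lambda>r. J2 V q nd m r \<rho>", OF \<theta>01 \<theta>02 \<theta>12 01 02 12] by blast
    then show "?Q \<theta>01 \<rho>"
      unfolding is_arg_min_Psi_bar_iff[OF \<open>V > 0\<close>]
      by (intro bexI[OF _ \<theta>02] bexI[OF _ \<theta>12] conjI exI[of _ I] ballI 02 12)
  qed
qed

end
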